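(* For each of the three representations $\mathcal{X}\in\{\mathcal{W},\mathcal{W}^m,\mathcal{L}\}$, the following decision problem is solvable in polynomial time. Input: a simple game $\Gamma$ on player set $N$, given by $N$ together with an explicit list of the coalitions in the family $\mathcal{X}$ of $\Gamma$ (all winning coalitions if $\mathcal{X}=\mathcal{W}$, all minimal winning coalitions if $\mathcal{X}=\mathcal{W}^m$, all losing coalitions if $\mathcal{X}=\mathcal{L}$), and two losing coalitions $S_1,S_2\in\mathcal{L}$ of $\Gamma$. Question: do there exist winning coalitions $S_3,S_4\in\mathcal{W}$ such that $(S_1,S_2,S_3,S_4)$ is a $2$-trade application of $\Gamma$?
   Context: A simple game $\Gamma$ is a pair $(N,\mathcal{W})$ where $N=\{1,\dots,n\}$ and $\mathcal{W}$ is a collection of subsets of $N$ such that (1) $N\in\mathcal{W}$, (2) $\emptyset\notin\mathcal{W}$, and (3) $S\in\mathcal{W}$ and $S\subseteq T\subseteq N$ imply $T\in\mathcal{W}$. Subsets of $N$ are called coalitions; those in $\mathcal{W}$ are winning, all others are losing, and $\mathcal{L}$ denotes the set of losing coalitions. $\mathcal{W}^m$ is the set of minimal winning coalitions (winning coalitions all of whose proper subsets are losing); it determines the game. A $j$-trade application of $\Gamma$ is a collection $(S_1,\dots,S_{2j})$ of $2j$ coalitions (repetitions allowed) for which there is $I\subseteq\{1,\dots,2j\}$ with $|I|=j$ such that for all $i\in\{1,\dots,2j\}$, $S_i\in\mathcal{W}\iff i\in I$, and for every $p\in N$, $|\{i\in I: p\in S_i\}|=|\{i\in\{1,\dots,2j\}\setminus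 I: p\in S_i\}|$. Running time is measured in the size of the input, i.e. of $N$, the explicit list of coalitions, and the given coalitions. *)

theory Defs
  imports Main "HOL-Computational_Algebra.Polynomial"
begin

section \<open>Simple games and trade applications\<close>

text \<open>The player set is \<open>N = {1..n}\<close>; a game is given by \<open>n\<close> and its family of winning coalitions.\<close>

definition simple_game :: "nat \<Rightarrow> nat set set \<Rightarrow> bool" where
  "simple_game n W \<longleftrightarrow>
     W \<subseteq> Pow {1..n} \<and> {1..n} \<in> W \<and> {} \<notin> W \<and>
     (\<forall>S T. S \<in> W \<and> S \<subseteq> T \<and> T \<subseteq> {1..n} \<longrightarrow> T \<in> W)"

definition losing :: "nat \<Rightarrow> nat set set \<Rightarrow> nat set set" where
  "losing n W = Pow {1..n} - W"

definition minimal_winning :: "nat set set \<Rightarrow> nat set set" where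
  "minimal_winning W = {S \<in> W. \<forall>T. T \<subset> S \<longrightarrow> T \<notin> W}"

text \<open>The sequence \<open>(S\<^sub>1, \<dots>, S\<^sub>2\<^sub>j)\<close> is a list, so that indices range over \<open>{0..<2*j}\<close>.\<close>

definition trade_application :: "nat \<Rightarrow> nat set set \<Rightarrow> nat \<Rightarrow> nat set list \<Rightarrow> bool" where
  "trade_application n W j Ss \<longleftrightarrow>
     length Ss = 2 * j \<and> set Ss \<subseteq> Pow {1..n} \<and>
     (\<exists>I \<subseteq> {0..<2*j}. card I = j \<and>
        (\<forall>i \<in> {0..<2*j}. Ss ! i \<in> W \<longleftrightarrow> i \<in> I) \<and>
        (\<forall>p \<in> {1..n}. card {i \<in> I. p \<in> Ss ! i} = card {i \<in> {0..<2*j} - I. p \<in> Ss ! i}))"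


section \<open>Polynomial time on deterministic multitape Turing machines\<close>

text \<open>
  States and tape symbols are natural numbers below \<open>num_states\<close> and \<open>num_symbols\<close>, so the
  relevant part of \<open>delta\<close> is a finite table. State \<open>0\<close> is initial and symbol \<open>0\<close> is the blank.
\<close>

datatype direction = Go_Left | Stay | Go_Right

record turing_machine =
  num_tapes :: nat
  num_states :: nat
  num_symbols :: nat
  accept :: nat
  reject :: nat
  delta :: "nat \<Rightarrow> nat list \<Rightarrow> nat \<times> (nat \<times> direction) list"

definition wf_tm :: "turing_machine \<Rightarrow> bool" where
  "wf_tm M \<longleftrightarrow>
     num_tapes M \<ge> 1 \<and> num_symbols M \<ge> 1 \<and> num_states M \<ge> 1 \<and>
     accept M < num_states M \<and> reject M < num_states M \<and> accept M \<noteq> reject M \<and>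
     (\<forall>q < num_states M. \<forall>rs. length rs = num_tapes M \<and> set rs \<subseteq> {..<num_symbols M} \<longrightarrow>
        (case delta M q rs of (q', as) \<Rightarrow>
           q' < num_states M \<and> length as = num_tapes M \<and> fst ` set as \<subseteq> {..<num_symbols M}))"

text \<open>A tape is its contents, indexed by the integers, together with the head position.\<close>

type_synonym tape = "(int \<Rightarrow> nat) \<times> int"

type_synonym config = "nat \<times> tape list"

definition read :: "tape \<Rightarrow> nat" where
  "read t = fst t (snd t)"

fun offset :: "direction \<Rightarrow> int" where
  "offset Go_Left = - 1"
| "offset Stay = 0"
| "offset Go_Right = 1"

fun act :: "nat \<times> direction \<Rightarrow> tape \<Rightarrow> tape" where
  "act (a, d) (t, h) = (t(h := a), h + offset d)"

fun step :: "turing_machine \<Rightarrow> config \<Rightarrow> config" where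
  "step M (q, ts) =
     (if q = accept M \<or> q = reject M then (q, ts)
      else case delta M q (map read ts) of (q', as) \<Rightarrow> (q', map2 act as ts))"

definition blank_tape :: tape where
  "blank_tape = (\<lambda>_. 0, 0)"

definition input_tape :: "nat list \<Rightarrow> tape" where
  "input_tape w = (\<lambda>i. if 0 \<le> i \<and> i < int (length w) then w ! nat i else 0, 0)"

definition init_config :: "turing_machine \<Rightarrow> nat list \<Rightarrow> config" where
  "init_config M w = (0, input_tape w # replicate (num_tapes M - 1) blank_tape)"

text \<open>
  Halting configurations are fixed points of \<open>step\<close>, so being in an accepting or rejecting
  state after exactly \<open>t\<close> steps means having halted within \<open>t\<close> steps.
\<close>

definition accepts_within :: "turing_machine \<Rightarrow> nat list \<Rightarrow> nat \<Rightarrow> bool" where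
  "accepts_within M w t \<longleftrightarrow> fst ((step M ^^ t) (init_config M w)) = accept M"

definition rejects_within :: "turing_machine \<Rightarrow> nat list \<Rightarrow> nat \<Rightarrow> bool" where
  "rejects_within M w t \<longleftrightarrow> fst ((step M ^^ t) (init_config M w)) = reject M"

text \<open>
  A decision problem consists of a set \<open>D\<close> of instances, the question \<open>Q\<close> asked about them and an
  encoding of instances as words over the nonblank symbols. A single machine and a single
  polynomial must serve all instances; nothing is required on words that encode no instance.
\<close>

definition poly_time_solvable :: "('a \<Rightarrow> nat list) \<Rightarrow> 'a set \<Rightarrow> ('a \<Rightarrow> bool) \<Rightarrow> bool" where
  "poly_time_solvable enc D Q \<longleftrightarrow>
     (\<exists>(M :: turing_machine) (p :: nat poly). wf_tm M \<and>
        (\<forall>x \<in> D. set (enc x) \<subseteq> {0<..<num_symbols M} \<and>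
           (if Q x then accepts_within M (enc x) (poly p (length (enc x)))
            else rejects_within M (enc x) (poly p (length (enc x))))))"


section \<open>The decision problems\<close>

datatype representation = Winning | Minimal_Winning | Losing

fun family :: "representation \<Rightarrow> nat \<Rightarrow> nat set set \<Rightarrow> nat set set" where
  "family Winning n W = W"
| "family Minimal_Winning n W = minimal_winning W"
| "family Losing n W = losing n W"

text \<open>
  An instance \<open>(n, W, Xs, S\<^sub>1, S\<^sub>2)\<close> carries the game \<open>W\<close> it is about, but the encoding below only
  shows the machine \<open>n\<close>, the list \<open>Xs\<close> of coalitions in the chosen family and \<open>S\<^sub>1, S\<^sub>2\<close>.
\<close>

type_synonym inst = "nat \<times> nat set set \<times> nat set list \<times> nat set \<times> nat set"

definition instances :: "representation \<Rightarrow> inst set" where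
  "instances X = {(n, W, Xs, S1, S2).
     simple_game n W \<and> distinct Xs \<and> set Xs = family X n W \<and>
     S1 \<in> losing n W \<and> S2 \<in> losing n W}"

fun extends_to_2_trade :: "inst \<Rightarrow> bool" where
  "extends_to_2_trade (n, W, Xs, S1, S2) \<longleftrightarrow>
     (\<exists>S3 \<in> W. \<exists>S4 \<in> W. trade_application n W 2 [S1, S2, S3, S4])"

text \<open>
  Coalitions are written as characteristic vectors of length \<open>n\<close> (\<open>1\<close> for absent, \<open>2\<close> for present),
  each terminated by the separator \<open>3\<close>; the player set itself comes first. As \<open>N\<close> is part of the
  input, this is polynomially equivalent to listing the members of every coalition.
\<close>

definition encode_coalition :: "nat \<Rightarrow> nat set \<Rightarrow> nat list" where
  "encode_coalition n S = map (\<lambda>p. if p \<in> S then 2 else 1) [1..<Suc n] @ [3]"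

fun encode :: "inst \<Rightarrow> nat list" where
  "encode (n, W, Xs, S1, S2) = concat (map (encode_coalition n) ({1..n} # S1 # S2 # Xs))"

end

theory Submission
  imports Defs
begin

text \<open>
  A \<open>2\<close>-trade with \<open>S\<^sub>1\<close>, \<open>S\<^sub>2\<close> is a pair of winning \<open>S\<^sub>3\<close>, \<open>S\<^sub>4\<close> with the same union \<open>U\<close> and intersection
  \<open>C\<close> as \<open>S\<^sub>1\<close>, \<open>S\<^sub>2\<close>. If (minimal) winning coalitions are listed, such a pair exists iff two listed
  coalitions \<open>A\<close>, \<open>B\<close> satisfy \<open>A \<union> B \<subseteq> U\<close> and \<open>A \<inter> B \<subseteq> C\<close>. If losing coalitions are listed, \<open>S\<^sub>3\<close> is a
  union of two of them, and a coalition is winning iff it is contained in no listed coalition. In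
  all cases the question reads \<open>\<exists>A. \<exists>B. \<forall>D. good A B D\<close> with variables ranging over the list, and \<open>good\<close>
  is decided by a finite automaton scanning the characteristic vectors in parallel. A Turing machine
  performs this cubic search with five copies of the input that it only reads.
\<close>

section \<open>Machines with an arbitrary finite set of states\<close>

lemma funpow_fixpoint_le:
  assumes "(f ^^ t) c = c'" "f c' = c'" "t \<le> T"
  shows "(f ^^ T) c = c'"
proof -
  have "(f ^^ (d + t)) c = c'" for d
    by (induction d) (use assms in auto)
  from this[of "T - t"] show ?thesis using assms(3) by simp
qed

fun tm_step :: "('q \<Rightarrow> nat list \<Rightarrow> 'q \<times> (nat \<times> direction) list) \<Rightarrow> 'q \<Rightarrow> 'q \<Rightarrow> 'q \<times> tape list \<Rightarrow> 'q \<times> tape list"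
  where
  "tm_step \<delta> a r (q, ts) =
     (if q = a \<or> q = r then (q, ts)
      else case \<delta> q (map read ts) of (q', as) \<Rightarrow> (q', map2 act as ts))"

text \<open>Numbering the states of \<open>Q\<close> turns a machine over any state type into one of
  the prescribed format, and the two machines run in lockstep. The rest of the development can then
  use structured states.\<close>

lemma poly_time_solvable_by_machine:
  fixes Q :: "'q set" and \<delta> :: "'q \<Rightarrow> nat list \<Rightarrow> 'q \<times> (nat \<times> direction) list"
  assumes fin: "finite Q" and q0: "q0 \<in> Q" and a: "a \<in> Q" and r: "r \<in> Q" and ar: "a \<noteq> r"
    and closed: "\<And>q rs. q \<in> Q \<Longrightarrow> fst (\<delta> q rs) \<in> Q"
    and acts: "\<And>q rs. q \<in> Q \<Longrightarrow> length rs = k \<Longrightarrow> set rs \<subseteq> {..<s} \<Longrightarrow>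
                 length (snd (\<delta> q rs)) = k \<and> fst ` set (snd (\<delta> q rs)) \<subseteq> {..<s}"
    and k: "k \<ge> 1" and s: "s \<ge> 1"
    and symbols: "\<And>x. x \<in> D \<Longrightarrow> set (enc x) \<subseteq> {0<..<s}"
    and run: "\<And>x. x \<in> D \<Longrightarrow>
        fst ((tm_step \<delta> a r ^^ poly p (length (enc x)))
               (q0, input_tape (enc x) # replicate (k - 1) blank_tape)) = (if P x then a else r)"
  shows "poly_time_solvable enc D P"
proof -
  obtain h :: "'q \<Rightarrow> nat" where h: "bij_betw h (Q - {q0}) {0..<card (Q - {q0})}"
    using ex_bij_betw_finite_nat[of "Q - {q0}"] fin by auto
  \<comment> \<open>The value 0 is reserved for \<open>q0\<close> because state 0 is initial;
    \<open>h\<close> numbers only the other states, shifted by one.\<close>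
  define code where "code q = (if q = q0 then 0 else Suc (h q))" for q
  \<comment> \<open>The default \<open>q0\<close> makes every number decode into \<open>Q\<close>,
    so the transition table is well formed everywhere.\<close>
  define decode where "decode m = (if m \<in> code ` Q then inv_into Q code m else q0)" for m
  define K where "K = Suc (card (Q - {q0}))"
  have inj: "inj_on code Q"
    using h unfolding code_def inj_on_def bij_betw_def by auto
  have bound: "code q < K" if "q \<in> Q" for q
  proof (cases "q = q0")
    case False
    then have "h q \<in> {0..<card (Q - {q0})}" using h that unfolding bij_betw_def by blast
    then show ?thesis using False by (simp add: code_def K_def)
  qed (simp add: code_def K_def)
  have dec: "decode (code q) = q" if "q \<in> Q" for q
    using that inj by (simp add: decode_def)
  have decQ: "decode m \<in> Q" for m
    using q0 by (auto simp: decode_def inv_into_into)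
  have code_eq: "code q = code q' \<longleftrightarrow> q = q'" if "q \<in> Q" "q' \<in> Q" for q q'
    using inj that by (meson inj_onD)
  define M where "M = \<lparr>num_tapes = k, num_states = K, num_symbols = s, accept = code a, reject = code r,
     delta = (\<lambda>m rs. case \<delta> (decode m) rs of (q, as) \<Rightarrow> (code q, as))\<rparr>"
  have wf: "wf_tm M"
  proof -
    have "case delta M m rs of (q', as) \<Rightarrow>
        q' < num_states M \<and> length as = num_tapes M \<and> fst ` set as \<subseteq> {..<num_symbols M}"
      if "length rs = num_tapes M" "set rs \<subseteq> {..<num_symbols M}" for m rs
    proof -
      obtain q' as where eq: "\<delta> (decode m) rs = (q', as)" by fastforce
      have "q' \<in> Q" "length as = k" "fst ` set as \<subseteq> {..<s}"
        using closed[OF decQ, of m rs] acts[OF decQ, of rs m] that by (simp_all add: eq M_def)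
      then show ?thesis using bound by (simp add: M_def eq)
    qed
    moreover have "num_states M \<ge> 1" by (simp add: M_def K_def)
    ultimately show ?thesis
      unfolding wf_tm_def using k s bound[OF a] bound[OF r] ar code_eq[OF a r]
      by (simp add: M_def)
  qed
  \<comment> \<open>Staying inside \<open>Q\<close> is carried along, since \<open>decode\<close> is
    known to invert \<open>code\<close> only there.\<close>
  have sim: "step M (code q, ts) = map_prod code id (tm_step \<delta> a r (q, ts)) \<and> fst (tm_step \<delta> a r (q, ts)) \<in> Q"
    if "q \<in> Q" for q ts
    using that closed[OF that, of "map read ts"] by (auto simp: M_def dec code_eq a r split: prod.splits)
  have sims: "(step M ^^ t) (code q0, ts) = map_prod code id ((tm_step \<delta> a r ^^ t) (q0, ts))
        \<and> fst ((tm_step \<delta> a r ^^ t) (q0, ts)) \<in> Q" for t ts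
  proof (induction t)
    case (Suc t)
    obtain q ts' where c: "(tm_step \<delta> a r ^^ t) (q0, ts) = (q, ts')" by fastforce
    show ?case using Suc sim[of q ts'] by (simp add: c id_def del: step.simps tm_step.simps)
  qed (use q0 in simp)
  have init: "init_config M w = (code q0, input_tape w # replicate (k - 1) blank_tape)" for w
    by (simp add: init_config_def M_def code_def)
  have "if P x then accepts_within M (enc x) (poly p (length (enc x)))
        else rejects_within M (enc x) (poly p (length (enc x)))" if "x \<in> D" for x
    unfolding accepts_within_def rejects_within_def init
    using sims run[OF that] by (simp add: M_def)
  moreover have "num_symbols M = s" by (simp add: M_def)
  ultimately show ?thesis
    unfolding poly_time_solvable_def using wf symbols by blast
qed

section \<open>Two-way automata with several reading heads\<close>

abbreviation symbol_at :: "nat list \<Rightarrow> int \<Rightarrow> nat" where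
  "symbol_at w \<equiv> fst (input_tape w)"

text \<open>Only the heads with index below \<open>k\<close> exist; the others are phantoms that see the blank.\<close>

fun mh_step :: "('q \<Rightarrow> (nat \<Rightarrow> nat) \<Rightarrow> 'q \<times> (nat \<Rightarrow> direction)) \<Rightarrow> 'q \<Rightarrow> 'q \<Rightarrow> nat \<Rightarrow> nat list
    \<Rightarrow> 'q \<times> (nat \<Rightarrow> int) \<Rightarrow> 'q \<times> (nat \<Rightarrow> int)" where
  "mh_step \<delta> a r k w (q, h) =
     (if q = a \<or> q = r then (q, h)
      else case \<delta> q (\<lambda>i. if i < k then symbol_at w (h i) else 0) of
        (q', d) \<Rightarrow> (q', \<lambda>i. h i + offset (d i)))"

text \<open>Each reading head gets its own tape. \<open>Copying\<close> puts the input on all tapes,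
  \<open>Rewinding\<close> brings the heads back in lockstep, and \<open>Running\<close> simulates
  the automaton, each tape writing back the symbol it reads. Encoded words contain no blank, so a
  blank on tape 0 marks either end of the input.\<close>

datatype 'q phase = Copying | Rewinding | Running 'q

fun mh_delta :: "('q \<Rightarrow> (nat \<Rightarrow> nat) \<Rightarrow> 'q \<times> (nat \<Rightarrow> direction)) \<Rightarrow> 'q \<Rightarrow> nat
    \<Rightarrow> 'q phase \<Rightarrow> nat list \<Rightarrow> 'q phase \<times> (nat \<times> direction) list" where
  "mh_delta \<delta> q0 k Copying rs =
     (if rs ! 0 = 0 then (Rewinding, map (\<lambda>_. (0, Go_Left)) rs)
      else (Copying, map (\<lambda>_. (rs ! 0, Go_Right)) rs))"
| "mh_delta \<delta> q0 k Rewinding rs =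
     (if rs ! 0 = 0 then (Running q0, map (\<lambda>b. (b, Go_Right)) rs)
      else (Rewinding, map (\<lambda>b. (b, Go_Left)) rs))"
| "mh_delta \<delta> q0 k (Running q) rs =
     (case \<delta> q (\<lambda>i. if i < k then rs ! i else 0) of
        (q', d) \<Rightarrow> (Running q', map (\<lambda>i. (rs ! i, d i)) [0..<k]))"

section \<open>Simulation of reading heads by tapes\<close>

lemma symbol_at_neq_0:
  assumes "0 \<notin> set w" "0 \<le> i" "i < int (length w)"
  shows "symbol_at w i \<noteq> 0"
proof -
  have "w ! nat i \<in> set w" using assms by (intro nth_mem) auto
  then have "w ! nat i \<noteq> 0" using assms(1) by metis
  then show ?thesis using assms by (simp add: input_tape_def)
qed

lemma symbol_at_int: "p < length w \<Longrightarrow> symbol_at w (int p) = w ! p"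
  by (simp add: input_tape_def)

lemma symbol_at_outside: "i < 0 \<or> i \<ge> int (length w) \<Longrightarrow> symbol_at w i = 0"
  by (auto simp: input_tape_def)

lemma copy_phase:
  assumes w: "0 \<notin> set w" and k: "k \<ge> 1" and j: "j \<le> length w"
  shows "(tm_step (mh_delta \<delta> q0 k) (Running a) (Running r) ^^ j)
      (Copying, input_tape w # replicate (k - 1) blank_tape) =
    (Copying, (symbol_at w, int j) #
       replicate (k - 1) (\<lambda>i. if i < int j then symbol_at w i else 0, int j))"
  using j
proof (induction j)
  case 0
  then show ?case
    by (auto simp: blank_tape_def input_tape_def)
next
  case (Suc j)
  have "symbol_at w (int j) \<noteq> 0"
    using symbol_at_neq_0[OF w, of "int j"] Suc.prems by simp
  moreover have "(\<lambda>i. if i < int j then symbol_at w i else 0)(int j := symbol_at w (int j)) =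
      (\<lambda>i. if i < int (Suc j) then symbol_at w i else 0)"
    by auto
  ultimately show ?case
    using Suc by (simp add: read_def add.commute)
qed

text \<open>The heads walk from \<open>j - 1\<close> down to the blank at position -1, and one more
  step to the right puts them on 0; this makes \<open>Suc j\<close> steps.\<close>

lemma rewind_phase:
  assumes w: "0 \<notin> set w" and k: "k \<ge> 1" and j: "j \<le> length w"
  shows "(tm_step (mh_delta \<delta> q0 k) (Running a) (Running r) ^^ Suc j)
      (Rewinding, replicate k (symbol_at w, int j - 1)) =
    (Running q0, replicate k (symbol_at w, 0))"
  using j
proof (induction j)
  case 0
  then show ?case
    using k by (simp add: read_def fun_upd_idem symbol_at_outside)
next
  case (Suc j)
  have "symbol_at w (int j) \<noteq> 0"
    using symbol_at_neq_0[OF w, of "int j"] Suc.prems by simp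
  then have "tm_step (mh_delta \<delta> q0 k) (Running a) (Running r)
      (Rewinding, replicate k (symbol_at w, int (Suc j) - 1)) =
      (Rewinding, replicate k (symbol_at w, int j - 1))"
    using k by (simp add: read_def)
  then show ?case
    using Suc by (simp add: funpow_Suc_right del: funpow.simps tm_step.simps)
qed

lemma run_phase:
  "tm_step (mh_delta \<delta> q0 k) (Running a) (Running r) (Running q, map (\<lambda>i. (symbol_at w, h i)) [0..<k]) =
   map_prod Running (\<lambda>h. map (\<lambda>i. (symbol_at w, h i)) [0..<k]) (mh_step \<delta> a r k w (q, h))"
proof -
  have "(\<lambda>i. if i < k then map read (map (\<lambda>i. (symbol_at w, h i)) [0..<k]) ! i else 0) =
      (\<lambda>i. if i < k then symbol_at w (h i) else 0)"
    by (auto simp: read_def)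
  then show ?thesis
    by (auto simp: read_def map2_map_map simp del: map_map split: prod.splits)
qed

text \<open>The setup costs \<open>length w + 1\<close> steps for copying, the last of them on the
  blank behind the input, and as many for rewinding. From then on each automaton step is one machine
  step by \<open>run_phase\<close>.\<close>

lemma tm_simulates_mh:
  assumes w: "0 \<notin> set w" and k: "k \<ge> 1"
  shows "(tm_step (mh_delta \<delta> q0 k) (Running a) (Running r) ^^ (t + (2 * length w + 2)))
      (Copying, input_tape w # replicate (k - 1) blank_tape) =
    map_prod Running (\<lambda>h. map (\<lambda>i. (symbol_at w, h i)) [0..<k])
      ((mh_step \<delta> a r k w ^^ t) (q0, \<lambda>_. 0))"
proof (induction t)
  case 0
  let ?f = "tm_step (mh_delta \<delta> q0 k) (Running a) (Running r)" and ?L = "length w"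
  let ?c = "(Copying, input_tape w # replicate (k - 1) blank_tape)"
  have full: "(\<lambda>i. if i < int ?L then symbol_at w i else 0) = symbol_at w"
    by (auto simp: input_tape_def)
  have "?f (Copying, (symbol_at w, int ?L) # replicate (k - 1) (symbol_at w, int ?L)) =
      (Rewinding, replicate (Suc (k - 1)) (symbol_at w, int ?L - 1))"
    by (auto simp: read_def symbol_at_outside)
  then have "(?f ^^ Suc ?L) ?c = (Rewinding, replicate k (symbol_at w, int ?L - 1))"
    using copy_phase[OF w k order.refl, of \<delta> q0 a r] k by (simp add: full del: tm_step.simps)
  then have "(?f ^^ (Suc ?L + Suc ?L)) ?c = (Running q0, replicate k (symbol_at w, 0))"
    using rewind_phase[OF w k order.refl, of \<delta> q0 a r]
    by (simp only: funpow_add o_apply)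
  then show ?case
    by (simp add: map_replicate_const mult_2 del: funpow.simps)
next
  case (Suc t)
  obtain q h where "(mh_step \<delta> a r k w ^^ t) (q0, \<lambda>_. 0) = (q, h)" by fastforce
  then show ?case
    using Suc run_phase[of \<delta> q0 k a r q w h] by (simp del: tm_step.simps mh_step.simps)
qed

lemma poly_time_solvable_by_multihead:
  fixes Q :: "'q set" and \<delta> :: "'q \<Rightarrow> (nat \<Rightarrow> nat) \<Rightarrow> 'q \<times> (nat \<Rightarrow> direction)"
  assumes fin: "finite Q" and q0: "q0 \<in> Q" and a: "a \<in> Q" and r: "r \<in> Q" and ar: "a \<noteq> r"
    and closed: "\<And>q f. q \<in> Q \<Longrightarrow> fst (\<delta> q f) \<in> Q"
    and k: "k \<ge> 1" and s: "s \<ge> 1"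
    and symbols: "\<And>x. x \<in> D \<Longrightarrow> set (enc x) \<subseteq> {0<..<s}"
    and run: "\<And>x. x \<in> D \<Longrightarrow> \<exists>t \<le> poly p (length (enc x)).
        fst ((mh_step \<delta> a r k (enc x) ^^ t) (q0, \<lambda>_. 0)) = (if P x then a else r)"
  shows "poly_time_solvable enc D P"
proof (rule poly_time_solvable_by_machine)
  let ?Q = "insert Copying (insert Rewinding (Running ` Q))"
  show "finite ?Q" "Copying \<in> ?Q" "Running a \<in> ?Q" "Running r \<in> ?Q" "Running a \<noteq> Running r"
    using fin a r ar by auto
  show "fst (mh_delta \<delta> q0 k q rs) \<in> ?Q" if "q \<in> ?Q" for q rs
    using that q0 closed
    by (cases q) (auto split: prod.splits simp: image_iff, metis fst_conv)
  show "length (snd (mh_delta \<delta> q0 k q rs)) = k \<and> fst ` set (snd (mh_delta \<delta> q0 k q rs)) \<subseteq> {..<s}"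
    if "length rs = k" "set rs \<subseteq> {..<s}" for q rs
  proof -
    have "rs ! i < s" if "i < k" for i
      using \<open>length rs = k\<close> \<open>set rs \<subseteq> {..<s}\<close> nth_mem[of i rs] that by blast
    then have "rs ! 0 < s" "\<forall>i < k. rs ! i < s" using k by simp_all
    then show ?thesis using that(1) k s
    proof (cases q)
      case Copying
      then show ?thesis using that(1) s \<open>rs ! 0 < s\<close> by auto
    next
      case Rewinding
      then show ?thesis using that by auto
    next
      case (Running q')
      then show ?thesis using \<open>\<forall>i < k. rs ! i < s\<close> by (auto split: prod.splits)
    qed
  qed
  show "k \<ge> 1" "s \<ge> 1" by fact+
  show "set (enc x) \<subseteq> {0<..<s}" if "x \<in> D" for x by (rule symbols[OF that])
  \<comment> \<open>The added polynomial \<open>[:2, 2:]\<close> is the setup cost of copying and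
    rewinding.\<close>
  show "fst ((tm_step (mh_delta \<delta> q0 k) (Running a) (Running r) ^^ poly (p + [:2, 2:]) (length (enc x)))
      (Copying, input_tape (enc x) # replicate (k - 1) blank_tape)) = (if P x then Running a else Running r)"
    if x: "x \<in> D" for x
  proof -
    let ?f = "mh_step \<delta> a r k (enc x)"
    have len: "poly (p + [:2, 2:]) (length (enc x)) = poly p (length (enc x)) + (2 * length (enc x) + 2)"
      by simp
    obtain t where t: "t \<le> poly p (length (enc x))"
      and fin: "fst ((?f ^^ t) (q0, \<lambda>_. 0)) = (if P x then a else r)"
      using run[OF x] by blast
    obtain q h where c: "(?f ^^ t) (q0, \<lambda>_. 0) = (q, h)" by fastforce
    \<comment> \<open>The automaton may halt early; a halting configuration is a fixed point and so
      persists up to the bound.\<close>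
    have "(?f ^^ poly p (length (enc x))) (q0, \<lambda>_. 0) = (q, h)"
      using c _ t by (rule funpow_fixpoint_le) (use fin c in \<open>auto split: if_splits\<close>)
    moreover have "0 \<notin> set (enc x)" using symbols[OF x] by auto
    from tm_simulates_mh[OF this k, where \<delta> = \<delta> and ?q0.0 = q0 and a = a and r = r and t = "poly p (length (enc x))"]
    have "(tm_step (mh_delta \<delta> q0 k) (Running a) (Running r) ^^ poly (p + [:2, 2:]) (length (enc x)))
      (Copying, input_tape (enc x) # replicate (k - 1) blank_tape) =
       map_prod Running (\<lambda>h. map (\<lambda>i. (symbol_at (enc x), h i)) [0..<k])
      ((?f ^^ poly p (length (enc x))) (q0, \<lambda>_. 0))"
      by (simp only: len)
    ultimately show ?thesis using fin c by (simp add: if_distrib)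
  qed
qed

section \<open>Reduction to a search over the listed coalitions\<close>

text \<open>In the case \<open>Losing\<close> the two sets are the candidates for the third and
  fourth coalition: both contain the intersection of \<open>S1\<close> and \<open>S2\<close>, and
  \<open>A \<union> B\<close> decides which of them receives each remaining player of the
  union.\<close>

fun good :: "representation \<Rightarrow> nat set \<Rightarrow> nat set \<Rightarrow> nat set \<Rightarrow> nat set \<Rightarrow> nat set \<Rightarrow> bool" where
  "good Losing S1 S2 A B D \<longleftrightarrow>
     \<not> S1 \<inter> S2 \<union> (S1 \<union> S2) \<inter> (A \<union> B) \<subseteq> D \<and> \<not> S1 \<inter> S2 \<union> ((S1 \<union> S2) - (A \<union> B)) \<subseteq> D"
| "good _ S1 S2 A B D \<longleftrightarrow> A \<union> B \<subseteq> S1 \<union> S2 \<and> A \<inter> B \<subseteq> S1 \<inter> S2"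

section \<open>Trades as pairs of winning coalitions with prescribed union and intersection\<close>

lemma trade_application_2_iff:
  assumes "S1 \<in> losing n W" "S2 \<in> losing n W" "S3 \<in> W" "S4 \<in> W" "W \<subseteq> Pow {1..n}"
  shows "trade_application n W 2 [S1, S2, S3, S4] \<longleftrightarrow> S3 \<inter> S4 = S1 \<inter> S2 \<and> S3 \<union> S4 = S1 \<union> S2"
proof -
  let ?Ss = "[S1, S2, S3, S4]"
  have four: "{0..<2 * 2} = {0, 1, 2, 3 :: nat}" by auto
  \<comment> \<open>The winning positions are forced: with indices from 0 they are 2 and 3.\<close>
  have win: "(\<forall>i \<in> {0..<2 * 2}. ?Ss ! i \<in> W \<longleftrightarrow> i \<in> I) \<longleftrightarrow> I = {2, 3}" if "I \<subseteq> {0..<2 * 2}" for I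
    using that assms unfolding four by (auto simp: losing_def)
  have diff: "{0..<2 * 2} - {2, 3} = {0, 1 :: nat}" by auto
  have "trade_application n W 2 ?Ss \<longleftrightarrow>
      (\<forall>p \<in> {1..n}. card {i \<in> {2, 3}. p \<in> ?Ss ! i} = card {i \<in> {0, 1}. p \<in> ?Ss ! i})"
  proof -
    have "set ?Ss \<subseteq> Pow {1..n}" using assms by (auto simp: losing_def)
    then have "length ?Ss = 2 * 2 \<and> set ?Ss \<subseteq> Pow {1..n}" by simp
    moreover define Q where "Q I \<longleftrightarrow>
      (\<forall>p \<in> {1..n}. card {i \<in> I. p \<in> ?Ss ! i} = card {i \<in> {0..<2*2} - I. p \<in> ?Ss ! i})" for I
    moreover have "(\<exists>I \<subseteq> {0..<2*2}. card I = 2 \<and> (\<forall>i \<in> {0..<2*2}. ?Ss ! i \<in> W \<longleftrightarrow> i \<in> I) \<and> Q I)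
      \<longleftrightarrow> Q {2, 3}" (is "?ex \<longleftrightarrow> _")
    proof
      assume ?ex
      then show "Q {2, 3}" using win by metis
    next
      assume "Q {2, 3}"
      moreover have "{2, 3} \<subseteq> {0..<2*2 :: nat}" "card {2, 3 :: nat} = 2" by auto
      ultimately show ?ex using win by metis
    qed
    ultimately have "trade_application n W 2 ?Ss \<longleftrightarrow> Q {2, 3}"
      unfolding trade_application_def Q_def by (simp only: simp_thms)
    then have "trade_application n W 2 ?Ss \<longleftrightarrow>
      (\<forall>p \<in> {1..n}. card {i \<in> {2, 3}. p \<in> ?Ss ! i} = card {i \<in> {0..<2*2} - {2, 3}. p \<in> ?Ss ! i})"
      unfolding Q_def .
    then show ?thesis unfolding diff .
  qed
  \<comment> \<open>Each count is 0, 1 or 2, and it is determined by whether \<open>p\<close> lies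
    in the union and whether it lies in the intersection.\<close>
  also have "\<dots> \<longleftrightarrow> (\<forall>p \<in> {1..n}. (p \<in> S3 \<inter> S4 \<longleftrightarrow> p \<in> S1 \<inter> S2) \<and> (p \<in> S3 \<union> S4 \<longleftrightarrow> p \<in> S1 \<union> S2))"
  proof (rule ball_cong[OF refl])
    fix p
    have "{i \<in> {2, 3}. p \<in> ?Ss ! i} = (if p \<in> S3 then {2} else {}) \<union> (if p \<in> S4 then {3} else {})"
      by (auto simp: nth_Cons')
    moreover have "{i \<in> {0, 1}. p \<in> ?Ss ! i} = (if p \<in> S1 then {0} else {}) \<union> (if p \<in> S2 then {1} else {})"
      by (auto simp: nth_Cons')
    ultimately show "card {i \<in> {2, 3}. p \<in> ?Ss ! i} = card {i \<in> {0, 1}. p \<in> ?Ss ! i} \<longleftrightarrow>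
        (p \<in> S3 \<inter> S4 \<longleftrightarrow> p \<in> S1 \<inter> S2) \<and> (p \<in> S3 \<union> S4 \<longleftrightarrow> p \<in> S1 \<union> S2)"
      by (simp only:) auto
  qed
  also have "\<dots> \<longleftrightarrow> S3 \<inter> S4 = S1 \<inter> S2 \<and> S3 \<union> S4 = S1 \<union> S2"
  proof -
    have "S1 \<subseteq> {1..n}" "S2 \<subseteq> {1..n}" "S3 \<subseteq> {1..n}" "S4 \<subseteq> {1..n}"
      using assms by (auto simp: losing_def)
    then show ?thesis by (auto simp: set_eq_iff subset_iff)
  qed
  finally show ?thesis .
qed

lemma extends_iff_union_inter:
  assumes "simple_game n W" "S1 \<in> losing n W" "S2 \<in> losing n W"
  shows "extends_to_2_trade (n, W, Xs, S1, S2) \<longleftrightarrow>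
    (\<exists>S3 \<in> W. \<exists>S4 \<in> W. S3 \<inter> S4 = S1 \<inter> S2 \<and> S3 \<union> S4 = S1 \<union> S2)"
  using trade_application_2_iff[OF assms(2,3)] assms(1) by (simp add: simple_game_def)

lemma minimal_winning_subset:
  assumes "simple_game n W" "S \<in> W"
  obtains A where "A \<in> minimal_winning W" "A \<subseteq> S"
proof -
  have "finite W" using assms(1) unfolding simple_game_def by (meson finite_Pow_iff finite_atLeastAtMost finite_subset)
  then obtain A where "A \<in> W" "A \<subseteq> S" and min: "\<forall>T \<in> W. T \<subseteq> A \<longrightarrow> A = T"
    using finite_has_minimal2[of W S] assms(2) by blast
  moreover have "A \<in> minimal_winning W" using \<open>A \<in> W\<close> min unfolding minimal_winning_def by blast
  ultimately show ?thesis using that by blast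
qed

text \<open>
  When winning coalitions are listed, it suffices to find the parts \<open>A \<subseteq> S\<^sub>3\<close> and \<open>B \<subseteq> S\<^sub>4\<close>, because
  all remaining players of \<open>(S\<^sub>1 \<union> S\<^sub>2) - B\<close> can be added to \<open>A\<close>. When losing coalitions are listed,
  \<open>S\<^sub>3\<close> is the union of the losing coalitions \<open>S\<^sub>3 \<inter> S\<^sub>1\<close> and \<open>S\<^sub>3 \<inter> S\<^sub>2\<close>, and it determines \<open>S\<^sub>4\<close>.
\<close>

lemma extends_iff_good:
  assumes "(n, W, Xs, S1, S2) \<in> instances X"
  shows "extends_to_2_trade (n, W, Xs, S1, S2) \<longleftrightarrow>
    (\<exists>A \<in> set Xs. \<exists>B \<in> set Xs. \<forall>D \<in> set Xs. good X S1 S2 A B D)"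
proof -
  have game: "simple_game n W" and S: "S1 \<in> losing n W" "S2 \<in> losing n W" and Xs: "set Xs = family X n W"
    using assms by (auto simp: instances_def)
  have mono: "T \<in> W" if "A \<in> W" "A \<subseteq> T" "T \<subseteq> {1..n}" for A T
    using game that by (auto simp: simple_game_def)
  have sub: "S1 \<subseteq> {1..n}" "S2 \<subseteq> {1..n}" using S by (auto simp: losing_def)
  have losing_mono: "A \<in> losing n W" if "A \<subseteq> T" "T \<in> losing n W" for A T
    using that mono[of A T] by (auto simp: losing_def)
  show ?thesis
  proof (cases "X = Losing")
    case True
    show ?thesis unfolding extends_iff_union_inter[OF game S]
    proof
      assume "\<exists>S3 \<in> W. \<exists>S4 \<in> W. S3 \<inter> S4 = S1 \<inter> S2 \<and> S3 \<union> S4 = S1 \<union> S2"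
      then obtain S3 S4 where W: "S3 \<in> W" "S4 \<in> W"
        and eq: "S3 \<inter> S4 = S1 \<inter> S2" "S3 \<union> S4 = S1 \<union> S2" by blast
      have "S1 \<inter> S2 \<union> (S1 \<union> S2) \<inter> (S3 \<inter> S1 \<union> S3 \<inter> S2) = S3"
        "S1 \<inter> S2 \<union> ((S1 \<union> S2) - (S3 \<inter> S1 \<union> S3 \<inter> S2)) = S4"
        using eq by blast+
      moreover have "\<not> T \<subseteq> D" if "T \<in> W" "D \<in> losing n W" for T D
        using losing_mono[of T D] that by (auto simp: losing_def)
      ultimately have "\<forall>D \<in> losing n W. good X S1 S2 (S3 \<inter> S1) (S3 \<inter> S2) D"
        using W True by simp
      moreover have "S3 \<inter> S1 \<in> losing n W" "S3 \<inter> S2 \<in> losing n W"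
        by (rule losing_mono[OF Int_lower2], fact S)+
      ultimately show "\<exists>A \<in> set Xs. \<exists>B \<in> set Xs. \<forall>D \<in> set Xs. good X S1 S2 A B D"
        using Xs True by auto
    next
      assume "\<exists>A \<in> set Xs. \<exists>B \<in> set Xs. \<forall>D \<in> set Xs. good X S1 S2 A B D"
      then obtain A B where AB: "\<forall>D \<in> losing n W. good Losing S1 S2 A B D" using Xs True by auto
      let ?S3 = "S1 \<inter> S2 \<union> (S1 \<union> S2) \<inter> (A \<union> B)" and ?S4 = "S1 \<inter> S2 \<union> ((S1 \<union> S2) - (A \<union> B))"
      \<comment> \<open>A losing candidate would itself be an admissible \<open>D\<close>, and it
        contains itself.\<close>
      have "?S3 \<notin> losing n W" "?S4 \<notin> losing n W" using AB by (metis good.simps(1) order.refl)+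
      then have "?S3 \<in> W" "?S4 \<in> W" using sub by (auto simp: losing_def)
      moreover have "?S3 \<inter> ?S4 = S1 \<inter> S2" "?S3 \<union> ?S4 = S1 \<union> S2" by blast+
      ultimately show "\<exists>S3 \<in> W. \<exists>S4 \<in> W. S3 \<inter> S4 = S1 \<inter> S2 \<and> S3 \<union> S4 = S1 \<union> S2" by blast
    qed
  next
    case False
    have refine: "\<exists>A \<in> set Xs. A \<subseteq> S" if S: "S \<in> W" for S
    proof -
      obtain A where "A \<in> minimal_winning W" "A \<subseteq> S"
        using minimal_winning_subset[OF game S] .
      then show ?thesis using Xs S False by (cases X) auto
    qed
    have XsW: "set Xs \<subseteq> W" using False Xs by (cases X) (auto simp: minimal_winning_def)
    have good: "good X S1 S2 A B D \<longleftrightarrow> A \<union> B \<subseteq> S1 \<union> S2 \<and> A \<inter> B \<subseteq> S1 \<inter> S2" for A B D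
      using False by (cases X) auto
    show ?thesis unfolding extends_iff_union_inter[OF game S]
    proof
      assume "\<exists>S3 \<in> W. \<exists>S4 \<in> W. S3 \<inter> S4 = S1 \<inter> S2 \<and> S3 \<union> S4 = S1 \<union> S2"
      then obtain S3 S4 where W: "S3 \<in> W" "S4 \<in> W"
        and eq: "S3 \<inter> S4 = S1 \<inter> S2" "S3 \<union> S4 = S1 \<union> S2" by blast
      obtain A B where "A \<in> set Xs" "A \<subseteq> S3" "B \<in> set Xs" "B \<subseteq> S4" using refine W by metis
      moreover from this have "A \<union> B \<subseteq> S3 \<union> S4" "A \<inter> B \<subseteq> S3 \<inter> S4" by auto
      ultimately show "\<exists>A \<in> set Xs. \<exists>B \<in> set Xs. \<forall>D \<in> set Xs. good X S1 S2 A B D"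
        unfolding good eq by blast
    next
      assume "\<exists>A \<in> set Xs. \<exists>B \<in> set Xs. \<forall>D \<in> set Xs. good X S1 S2 A B D"
      then obtain A B where AB: "A \<in> W" "B \<in> W" "A \<union> B \<subseteq> S1 \<union> S2" "A \<inter> B \<subseteq> S1 \<inter> S2"
        unfolding good using XsW by blast
      \<comment> \<open>\<open>?S4\<close> is the smallest enlargement of \<open>B\<close>
        containing the required intersection, and \<open>?S3\<close> is then forced. It contains
        \<open>A\<close>, because a player of \<open>A\<close> outside the intersection cannot be in
        \<open>B\<close>.\<close>
      let ?S3 = "S1 \<inter> S2 \<union> ((S1 \<union> S2) - B)" and ?S4 = "B \<union> S1 \<inter> S2"
      have "A \<subseteq> ?S3" "?S3 \<subseteq> {1..n}" "B \<subseteq> ?S4" "?S4 \<subseteq> {1..n}" using AB sub by blast+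
      then have "?S3 \<in> W" "?S4 \<in> W" using AB(1,2) mono by metis+
      moreover have "?S3 \<inter> ?S4 = S1 \<inter> S2" "?S3 \<union> ?S4 = S1 \<union> S2" using AB by blast+
      ultimately show "\<exists>S3 \<in> W. \<exists>S4 \<in> W. S3 \<inter> S4 = S1 \<inter> S2 \<and> S3 \<union> S4 = S1 \<union> S2" by blast
    qed
  qed
qed

section \<open>A five-head automaton performing the search\<close>

text \<open>
  Heads \<open>0\<close> and \<open>1\<close> stay on \<open>S\<^sub>1\<close> and \<open>S\<^sub>2\<close>; heads \<open>2\<close>, \<open>3\<close>, \<open>4\<close> carry the loop variables \<open>A\<close>,
  \<open>B\<close>, \<open>D\<close>. \<open>Skip i k\<close> moves head \<open>i\<close> past \<open>k + 1\<close> separators. The flags in \<open>Scan\<close> tell whether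
  the two conjuncts of \<open>good\<close> hold for the players scanned so far.
\<close>

datatype state = Skip nat nat | Rewind nat | Loop nat | Scan "bool \<times> bool" | Back bool | Acc | Rej

definition states :: "state set" where
  "states = (\<lambda>(i, k). Skip i k) ` ({..<5} \<times> {..<3}) \<union> Rewind ` {..<5} \<union> Loop ` {..<5}
     \<union> range Scan \<union> range Back \<union> {Acc, Rej}"

text \<open>The block of the player set comes first, so heads 0, 1 and 2 skip one, two and three
  blocks to reach \<open>S1\<close>, \<open>S2\<close> and the first listed coalition. Starting from
  \<open>Skip 0 0\<close>, these three skips are chained here; every other completed skip enters the
  loop of its head.\<close>

definition after_skip :: "nat \<Rightarrow> nat \<Rightarrow> state" where
  "after_skip i k =
     (if k > 0 then Skip i (k - 1) else if i = 0 then Skip 1 1 else if i = 1 then Skip 2 2 else Loop i)"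

text \<open>Symbol 2 means presence; \<open>u\<close>, \<open>c\<close> and \<open>e\<close> say
  whether the current player is in the union of \<open>S1\<close> and \<open>S2\<close>, in their
  intersection, and in \<open>A \<union> B\<close>. For \<open>Losing\<close> a flag records a
  player violating an inclusion, hence the disjunctions; otherwise it records that an inclusion
  still holds.\<close>

fun update_flags :: "representation \<Rightarrow> (nat \<Rightarrow> nat) \<Rightarrow> bool \<times> bool \<Rightarrow> bool \<times> bool" where
  "update_flags X r (f, g) =
     (let u = (r 0 = 2 \<or> r 1 = 2); c = (r 0 = 2 \<and> r 1 = 2); e = (r 2 = 2 \<or> r 3 = 2) in
      if X = Losing then (f \<or> (c \<or> u \<and> e) \<and> r 4 \<noteq> 2, g \<or> (c \<or> u \<and> \<not> e) \<and> r 4 \<noteq> 2)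
      else (f \<and> (e \<longrightarrow> u), g \<and> (r 2 = 2 \<and> r 3 = 2 \<longrightarrow> c)))"

definition move :: "nat set \<Rightarrow> direction \<Rightarrow> nat \<Rightarrow> direction" where
  "move I d = (\<lambda>i. if i \<in> I then d else Stay)"

text \<open>\<open>Loop 2\<close>, \<open>Loop 3\<close> and \<open>Loop 4\<close> are the tops of
  nested loops over \<open>A\<close>, \<open>B\<close> and \<open>D\<close>, and a blank means that
  the list is exhausted. Running out of \<open>D\<close> accepts, running out of \<open>B\<close>
  advances \<open>A\<close>, running out of \<open>A\<close> rejects, and a failed test advances
  \<open>B\<close>. After a scan head 4 stays on the next block while the other heads walk back, so
  \<open>D\<close> is advanced at no extra cost.\<close>

fun transition :: "representation \<Rightarrow> state \<Rightarrow> (nat \<Rightarrow> nat) \<Rightarrow> state \<times> (nat \<Rightarrow> direction)" where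
  "transition X (Skip i k) r = (if r i = 3 then after_skip i k else Skip i k, move {i} Go_Right)"
| "transition X (Rewind i) r =
     (if r i = 0 then (Skip i 2, move {i} Go_Right) else (Rewind i, move {i} Go_Left))"
| "transition X (Loop i) r =
     (if i = 4 then (if r 4 = 0 then Acc else Scan (X \<noteq> Losing, X \<noteq> Losing), move {} Stay)
      else if r i \<noteq> 0 then (Rewind (Suc i), move {Suc i} Go_Left)
      else (if i = 3 then Skip 2 0 else Rej, move {} Stay))"
| "transition X (Scan s) r =
     (if r 0 = 3 then (Back (fst s \<and> snd s), \<lambda>i. if i = 4 then Go_Right else move {..<4} Go_Left i)
      else (Scan (update_flags X r s), move {..<5} Go_Right))"
| "transition X (Back b) r =
     (if r 0 = 3 then (if b then Loop 4 else Skip 3 0, move {..<4} Go_Right)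
      else (Back b, move {..<4} Go_Left))"
| "transition X Acc r = (Acc, move {} Stay)"
| "transition X Rej r = (Rej, move {} Stay)"

lemma finite_states: "finite states"
  by (simp add: states_def)

lemma transition_closed: "q \<in> states \<Longrightarrow> fst (transition X q r) \<in> states"
  by (cases q) (auto simp: states_def after_skip_def image_iff)

text \<open>Bounding the number of steps instead of fixing it lets branches of different length
  share one estimate.\<close>

definition reaches :: "('c \<Rightarrow> 'c) \<Rightarrow> 'c \<Rightarrow> nat \<Rightarrow> 'c \<Rightarrow> bool" where
  "reaches f c t c' \<longleftrightarrow> (\<exists>t' \<le> t. (f ^^ t') c = c')"

lemma reaches_refl: "reaches f c t c"
  unfolding reaches_def by (intro exI[of _ 0]) simp

lemma reaches_trans: "reaches f c s d \<Longrightarrow> reaches f d t e \<Longrightarrow> s + t \<le> u \<Longrightarrow> reaches f c u e"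
  unfolding reaches_def by (metis add.commute add_mono comp_apply funpow_add order.trans)

lemma reaches_mono: "reaches f c s d \<Longrightarrow> s \<le> u \<Longrightarrow> reaches f c u d"
  unfolding reaches_def using order.trans by blast

lemma reaches_step: "f c = d \<Longrightarrow> reaches f d t e \<Longrightarrow> Suc t \<le> u \<Longrightarrow> reaches f c u e"
  by (rule reaches_trans[of f c 1 d t]) (auto simp: reaches_def intro: exI[of _ 1])

text \<open>This is the scan invariant: the conjuncts of \<open>good\<close> restricted to the first
  \<open>j\<close> players. At \<open>j = n\<close> the restriction disappears.\<close>

definition flags :: "representation \<Rightarrow> nat set \<Rightarrow> nat set \<Rightarrow> nat set \<Rightarrow> nat set \<Rightarrow> nat set \<Rightarrow> nat \<Rightarrow> bool \<times> bool"
  where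
  "flags X S1 S2 A B D j =
     (if X = Losing
      then (\<not> {1..j} \<inter> (S1 \<inter> S2 \<union> (S1 \<union> S2) \<inter> (A \<union> B)) \<subseteq> D,
            \<not> {1..j} \<inter> (S1 \<inter> S2 \<union> ((S1 \<union> S2) - (A \<union> B))) \<subseteq> D)
      else ({1..j} \<inter> (A \<union> B) \<subseteq> S1 \<union> S2, {1..j} \<inter> (A \<inter> B) \<subseteq> S1 \<inter> S2))"

lemma flags_0: "flags X S1 S2 A B D 0 = (X \<noteq> Losing, X \<noteq> Losing)"
  by (simp add: flags_def)

lemma interval_Suc_subset:
  "{1..Suc j} \<inter> T \<subseteq> D \<longleftrightarrow> {1..j} \<inter> T \<subseteq> D \<and> (Suc j \<in> T \<longrightarrow> Suc j \<in> D)"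
  by (auto simp: atLeastAtMostSuc_conv)

lemma flags_Suc:
  assumes "r 0 = 2 \<longleftrightarrow> Suc j \<in> S1" "r 1 = 2 \<longleftrightarrow> Suc j \<in> S2" "r 2 = 2 \<longleftrightarrow> Suc j \<in> A"
    "r 3 = 2 \<longleftrightarrow> Suc j \<in> B" "r 4 = 2 \<longleftrightarrow> Suc j \<in> D"
  shows "flags X S1 S2 A B D (Suc j) = update_flags X r (flags X S1 S2 A B D j)"
  unfolding flags_def interval_Suc_subset update_flags.simps Let_def assms if_distrib[of "update_flags X r"]
  by (auto simp del: One_nat_def)

lemma flags_good:
  assumes "S1 \<subseteq> {1..n}" "S2 \<subseteq> {1..n}" "A \<subseteq> {1..n}" "B \<subseteq> {1..n}"
  shows "fst (flags X S1 S2 A B D n) \<and> snd (flags X S1 S2 A B D n) \<longleftrightarrow> good X S1 S2 A B D"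
proof -
  have "{1..n} \<inter> T = T" if "T \<subseteq> S1 \<union> S2 \<or> T \<subseteq> A \<union> B" for T using that assms by blast
  note this[of "S1 \<inter> S2 \<union> (S1 \<union> S2) \<inter> (A \<union> B)"] this[of "S1 \<inter> S2 \<union> ((S1 \<union> S2) - (A \<union> B))"]
    this[of "A \<union> B"] this[of "A \<inter> B"]
  then have "{1..n} \<inter> (S1 \<inter> S2 \<union> (S1 \<union> S2) \<inter> (A \<union> B)) = S1 \<inter> S2 \<union> (S1 \<union> S2) \<inter> (A \<union> B)"
    "{1..n} \<inter> (S1 \<inter> S2 \<union> ((S1 \<union> S2) - (A \<union> B))) = S1 \<inter> S2 \<union> ((S1 \<union> S2) - (A \<union> B))"
    "{1..n} \<inter> (A \<union> B) = A \<union> B" "{1..n} \<inter> (A \<inter> B) = A \<inter> B"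
    by blast+
  then show ?thesis unfolding flags_def by (cases X) simp_all
qed

text \<open>Phantom heads start at 0 and never move, so the default 0 makes configurations equal as
  functions.\<close>

definition heads :: "int \<Rightarrow> int \<Rightarrow> int \<Rightarrow> int \<Rightarrow> int \<Rightarrow> nat \<Rightarrow> int" where
  "heads x0 x1 x2 x3 x4 =
     (\<lambda>i. if i = 0 then x0 else if i = 1 then x1 else if i = 2 then x2 else if i = 3 then x3
          else if i = 4 then x4 else 0)"

lemma heads_simps [simp]:
  "heads x0 x1 x2 x3 x4 0 = x0" "heads x0 x1 x2 x3 x4 (Suc 0) = x1" "heads x0 x1 x2 x3 x4 2 = x2"
  "heads x0 x1 x2 x3 x4 3 = x3" "heads x0 x1 x2 x3 x4 4 = x4"
  "(heads x0 x1 x2 x3 x4)(0 := y) = heads y x1 x2 x3 x4"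
  "(heads x0 x1 x2 x3 x4)(Suc 0 := y) = heads x0 y x2 x3 x4"
  "(heads x0 x1 x2 x3 x4)(2 := y) = heads x0 x1 y x3 x4"
  "(heads x0 x1 x2 x3 x4)(3 := y) = heads x0 x1 x2 y x4"
  "(heads x0 x1 x2 x3 x4)(4 := y) = heads x0 x1 x2 x3 y"
  by (auto simp: heads_def)

lemma move_single: "(\<lambda>i. h i + offset (move {j} d i)) = h(j := h j + offset d)"
  by (auto simp: move_def)

lemma move_none: "(\<lambda>i. h i + offset (move {} d i)) = h"
  by (auto simp: move_def)

lemma move_all:
  "(\<lambda>i. heads x0 x1 x2 x3 x4 i + offset (move {..<5} Go_Right i)) =
     heads (x0 + 1) (x1 + 1) (x2 + 1) (x3 + 1) (x4 + 1)"
  by (auto simp: move_def heads_def)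

lemma move_four:
  "(\<lambda>i. heads x0 x1 x2 x3 x4 i + offset (move {..<4} d i)) =
     heads (x0 + offset d) (x1 + offset d) (x2 + offset d) (x3 + offset d) x4"
  by (auto simp: move_def heads_def)

lemma move_back:
  "(\<lambda>i. heads x0 x1 x2 x3 x4 i + offset (if i = 4 then Go_Right else move {..<4} Go_Left i)) =
     heads (x0 - 1) (x1 - 1) (x2 - 1) (x3 - 1) (x4 + 1)"
  by (auto simp: move_def heads_def)

section \<open>Layout of the encoded input\<close>

lemma length_encode_coalition: "length (encode_coalition n S) = Suc n"
  by (simp add: encode_coalition_def)

lemma nth_encode_coalition:
  "j \<le> n \<Longrightarrow> encode_coalition n S ! j = (if j = n then 3 else if Suc j \<in> S then 2 else 1)"
  by (auto simp: encode_coalition_def nth_append simp del: upt_Suc)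

lemma length_encoding: "length (concat (map (encode_coalition n) Bs)) = length Bs * Suc n"
  by (induction Bs) (simp_all add: length_encode_coalition)

lemma nth_encoding:
  "b < length Bs \<Longrightarrow> j \<le> n \<Longrightarrow>
     concat (map (encode_coalition n) Bs) ! (b * Suc n + j) = encode_coalition n (Bs ! b) ! j"
proof (induction Bs arbitrary: b)
  case (Cons B Bs)
  show ?case
  proof (cases b)
    case 0
    then show ?thesis using Cons.prems by (simp add: nth_append length_encode_coalition)
  next
    case (Suc b')
    have "Suc b' * Suc n + j = length (encode_coalition n B) + (b' * Suc n + j)"
      by (simp add: length_encode_coalition)
    then show ?thesis using Suc Cons by (simp only: list.map concat.simps nth_append_length_plus) simp
  qed
qed simp

lemma set_encoding: "set (concat (map (encode_coalition n) Bs)) \<subseteq> {0<..<4}"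
  by (auto simp: encode_coalition_def)

text \<open>\<open>Bs\<close> stands for the player set, \<open>S1\<close>, \<open>S2\<close> and
  then the listed coalitions, which is why the search ranges over indices from 3 on.\<close>

locale search =
  fixes X :: representation and n :: nat and Bs :: "nat set list"
  assumes Bs: "3 \<le> length Bs" "\<And>B. B \<in> set Bs \<Longrightarrow> B \<subseteq> {1..n}"
begin

definition "w = concat (map (encode_coalition n) Bs)"

abbreviation "m \<equiv> length Bs"

text \<open>Blocks have length \<open>Suc n\<close>. Offset \<open>j < n\<close> belongs to player
  \<open>Suc j\<close>, offset \<open>n\<close> to the separator, and \<open>pos m 0\<close> is the
  first blank after the input.\<close>

definition pos :: "nat \<Rightarrow> nat \<Rightarrow> int" where "pos b j = int (b * Suc n + j)"

definition sat :: "nat \<Rightarrow> nat \<Rightarrow> nat \<Rightarrow> bool" where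
  "sat a b d \<longleftrightarrow> good X (Bs ! 1) (Bs ! 2) (Bs ! a) (Bs ! b) (Bs ! d)"

abbreviation "mstep \<equiv> mh_step (transition X) Acc Rej 5 w"

lemma length_w: "length w = m * Suc n"
  unfolding w_def by (rule length_encoding)

lemma zero_notin_w: "0 \<notin> set w"
  using set_encoding[of n Bs] unfolding w_def by auto

lemma pos_less: "b < m \<Longrightarrow> j \<le> n \<Longrightarrow> pos b j < int (length w)"
proof -
  assume "b < m" "j \<le> n"
  then have "b * Suc n + j < Suc b * Suc n" "Suc b * Suc n \<le> m * Suc n"
    by (simp, intro mult_le_mono1) simp
  then show ?thesis unfolding pos_def length_w by linarith
qed

lemma symbol_at_pos:
  assumes "b < m" "j \<le> n"
  shows "symbol_at w (pos b j) = (if j = n then 3 else if Suc j \<in> Bs ! b then 2 else 1)"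
proof -
  have "symbol_at w (pos b j) = w ! (b * Suc n + j)"
    unfolding pos_def using pos_less[OF assms] unfolding pos_def of_nat_less_iff by (rule symbol_at_int)
  then show ?thesis using assms by (simp only: w_def nth_encoding nth_encode_coalition)
qed

lemma symbol_at_end: "symbol_at w (pos m 0) = 0"
  by (rule symbol_at_outside) (simp add: pos_def length_w)

lemma pos_next: "pos b n + 1 = pos (Suc b) 0" "pos b (Suc j) = pos b j + 1" "pos 0 0 = 0"
  by (simp_all add: pos_def)

section \<open>Movements of a single head\<close>

lemma skip_block:
  assumes "i < 5" "b < m" "j \<le> n" "h i = pos b j"
  shows "reaches mstep (Skip i k, h) (Suc n - j) (after_skip i k, h(i := pos (Suc b) 0))"
  using assms(3,4)
proof (induction "n - j" arbitrary: j h)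
  case 0
  then have "j = n" by simp
  then have "mstep (Skip i k, h) = (after_skip i k, h(i := pos (Suc b) 0))"
    using 0 assms by (simp add: symbol_at_pos move_single pos_next)
  then show ?case by (rule reaches_step[OF _ reaches_refl[of _ _ 0]]) (simp add: \<open>j = n\<close>)
next
  case (Suc x)
  then have j: "j < n" by simp
  then have "mstep (Skip i k, h) = (Skip i k, h(i := pos b (Suc j)))"
    using Suc.prems assms by (simp add: symbol_at_pos move_single pos_next)
  moreover have "reaches mstep (Skip i k, h(i := pos b (Suc j))) (Suc n - Suc j)
      (after_skip i k, (h(i := pos b (Suc j)))(i := pos (Suc b) 0))"
    using Suc.hyps j by (intro Suc.hyps(1)) auto
  ultimately show ?case using j by (auto intro: reaches_step)
qed

lemma skip:
  assumes "i < 5" "b + k < m" "h i = pos b 0"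
  shows "reaches mstep (Skip i k, h) (Suc k * Suc n) (after_skip i 0, h(i := pos (Suc (b + k)) 0))"
  using assms(2,3)
proof (induction k arbitrary: b h)
  case 0
  then show ?case using skip_block[of i b 0 h 0] assms(1) by (simp del: fun_upd_apply)
next
  case (Suc k)
  have "reaches mstep (Skip i (Suc k), h) (Suc n) (Skip i k, h(i := pos (Suc b) 0))"
    using skip_block[of i b 0 h "Suc k"] assms(1) Suc.prems by (simp add: after_skip_def)
  moreover have "reaches mstep (Skip i k, h(i := pos (Suc b) 0)) (Suc k * Suc n)
      (after_skip i 0, (h(i := pos (Suc b) 0))(i := pos (Suc (Suc b + k)) 0))"
    using Suc.prems by (intro Suc.IH) auto
  then have "reaches mstep (Skip i k, h(i := pos (Suc b) 0)) (Suc k * Suc n)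
      (after_skip i 0, h(i := pos (Suc (b + Suc k)) 0))"
    by (simp only: fun_upd_upd add_Suc add_Suc_right)
  ultimately show ?case by (rule reaches_trans) simp
qed

lemma rewind:
  assumes "i < 5" "p \<le> length w" "h i = int p - 1"
  shows "reaches mstep (Rewind i, h) (Suc p) (Skip i 2, h(i := 0))"
  using assms(2,3)
proof (induction p arbitrary: h)
  case 0
  then have "mstep (Rewind i, h) = (Skip i 2, h(i := 0))"
    using assms(1) by (simp add: symbol_at_outside move_single)
  then show ?case by (rule reaches_step[OF _ reaches_refl[of _ _ 0]]) simp
next
  case (Suc p)
  then have "symbol_at w (h i) \<noteq> 0"
    by (intro symbol_at_neq_0 zero_notin_w) auto
  then have "mstep (Rewind i, h) = (Rewind i, h(i := int p - 1))"
    using assms(1) Suc.prems by (simp add: move_single)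
  moreover have "reaches mstep (Rewind i, h(i := int p - 1)) (Suc p) (Skip i 2, (h(i := int p - 1))(i := 0))"
    using Suc.prems by (intro Suc.IH) auto
  then have "reaches mstep (Rewind i, h(i := int p - 1)) (Suc p) (Skip i 2, h(i := 0))"
    by (simp only: fun_upd_upd)
  ultimately show ?case by (rule reaches_step) simp
qed

text \<open>The head starts one cell left of a block boundary because \<open>Loop\<close> moves it
  before rewinding; otherwise a head on the blank behind the input would take it for the left
  end.\<close>

lemma rewind_skip:
  assumes "i \<in> {3, 4}" "b \<le> m" "h i = pos b 0 - 1"
  shows "reaches mstep (Rewind i, h) (Suc (2 * length w)) (Loop i, h(i := pos 3 0))"
proof (rule reaches_trans)
  have "b * Suc n \<le> length w" using assms(2) unfolding length_w by (rule mult_le_mono1)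
  then show "reaches mstep (Rewind i, h) (Suc (b * Suc n)) (Skip i 2, h(i := 0))"
    using assms by (intro rewind) (auto simp: pos_def)
  have "reaches mstep (Skip i 2, h(i := 0)) (Suc 2 * Suc n)
      (after_skip i 0, (h(i := 0))(i := pos (Suc (0 + 2)) 0))"
    using assms(1) Bs(1) by (intro skip) (auto simp: pos_next)
  then show "reaches mstep (Skip i 2, h(i := 0)) (Suc 2 * Suc n) (Loop i, h(i := pos 3 0))"
    using assms(1) by (auto simp: after_skip_def numeral_3_eq_3)
  have "Suc 2 * Suc n \<le> length w" using Bs(1) unfolding length_w by (intro mult_le_mono1) simp
  then show "Suc (b * Suc n) + Suc 2 * Suc n \<le> Suc (2 * length w)"
    using \<open>b * Suc n \<le> length w\<close> by linarith
qed

section \<open>The three nested loops\<close>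

definition H :: "nat \<Rightarrow> nat \<Rightarrow> nat \<Rightarrow> nat \<Rightarrow> int" where
  "H a b d = heads (pos 1 0) (pos 2 0) (pos a 0) (pos b 0) (pos d 0)"

abbreviation "F a b d \<equiv> flags X (Bs ! 1) (Bs ! 2) (Bs ! a) (Bs ! b) (Bs ! d)"

lemma scan:
  assumes "a < m" "b < m" "d < m" "j \<le> n"
  shows "reaches mstep
      (Scan (F a b d j), heads (pos 1 j) (pos 2 j) (pos a j) (pos b j) (pos d j)) (Suc n - j)
      (Back (sat a b d), heads (pos 1 n - 1) (pos 2 n - 1) (pos a n - 1) (pos b n - 1) (pos (Suc d) 0))"
  using assms(4)
proof (induction "n - j" arbitrary: j)
  case 0
  then have j: "j = n" by simp
  have "Bs ! i \<subseteq> {1..n}" if "i < m" for i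
    using Bs(2) that by (meson nth_mem)
  then have "fst (F a b d n) \<and> snd (F a b d n) \<longleftrightarrow> sat a b d"
    unfolding sat_def using Bs(1) assms by (intro flags_good) auto
  moreover have "symbol_at w (pos 1 n) = 3"
    using Bs(1) by (simp add: symbol_at_pos)
  ultimately show ?case
    by (intro reaches_step[OF _ reaches_refl[of _ _ 0]])
      (simp_all add: j move_back pos_next[symmetric])
next
  case (Suc x)
  then have j: "j < n" by simp
  let ?h = "heads (pos 1 j) (pos 2 j) (pos a j) (pos b j) (pos d j)"
  let ?r = "\<lambda>i. if i < 5 then symbol_at w (?h i) else 0"
  have "F a b d (Suc j) = update_flags X ?r (F a b d j)"
    using j Bs(1) assms by (intro flags_Suc) (simp_all add: symbol_at_pos)
  moreover have "symbol_at w (pos 1 j) \<noteq> 3"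
    using Bs(1) j by (simp add: symbol_at_pos)
  ultimately have "mstep (Scan (F a b d j), ?h) = (Scan (F a b d (Suc j)),
      heads (pos 1 (Suc j)) (pos 2 (Suc j)) (pos a (Suc j)) (pos b (Suc j)) (pos d (Suc j)))"
    by (simp add: move_all pos_next del: One_nat_def)
  then show ?case
    by (rule reaches_step[OF _ Suc.hyps(1)]) (use Suc.hyps j in auto)
qed

text \<open>Head 0 recognises the start of \<open>S1\<close> by the separator of the preceding
  player set block; the three other heads move in parallel with it.\<close>

lemma walk_back:
  assumes "a < m" "b < m" "j \<le> n"
  shows "reaches mstep
      (Back ok, heads (pos 1 j - 1) (pos 2 j - 1) (pos a j - 1) (pos b j - 1) y) (Suc j)
      (if ok then Loop 4 else Skip 3 0, heads (pos 1 0) (pos 2 0) (pos a 0) (pos b 0) y)"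
  using assms(3)
proof (induction j)
  case 0
  have "symbol_at w (pos 1 0 - 1) = 3"
  proof -
    have "pos 1 0 - 1 = pos 0 n" by (simp add: pos_def)
    moreover have "0 < m" using Bs(1) by linarith
    ultimately show ?thesis by (simp only: symbol_at_pos order.refl simp_thms if_True)
  qed
  then show ?case
    by (intro reaches_step[OF _ reaches_refl[of _ _ 0]]) (simp_all add: move_four)
next
  case (Suc j)
  have "symbol_at w (pos 1 j) \<noteq> 3"
    using Suc.prems Bs(1) by (simp add: symbol_at_pos)
  then have "mstep (Back ok, heads (pos 1 (Suc j) - 1) (pos 2 (Suc j) - 1) (pos a (Suc j) - 1) (pos b (Suc j) - 1) y)
      = (Back ok, heads (pos 1 j - 1) (pos 2 j - 1) (pos a j - 1) (pos b j - 1) y)"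
    by (simp add: move_four pos_next)
  then show ?case
    by (rule reaches_step[OF _ Suc.IH]) (use Suc.prems in auto)
qed

lemma symbol_at_block: "b < m \<Longrightarrow> symbol_at w (pos b 0) \<noteq> 0"
  by (simp add: symbol_at_pos)

lemma test:
  assumes "a < m" "b < m" "d < m"
  shows "reaches mstep (Loop 4, H a b d) (2 * n + 3) (if sat a b d then Loop 4 else Skip 3 0, H a b (Suc d))"
proof (rule reaches_step)
  show "mstep (Loop 4, H a b d) = (Scan (F a b d 0), H a b d)"
    using symbol_at_block[OF assms(3)] by (simp add: H_def move_none flags_0)
  show "reaches mstep (Scan (F a b d 0), H a b d) (Suc n + Suc n)
      (if sat a b d then Loop 4 else Skip 3 0, H a b (Suc d))"
    using reaches_trans[OF scan walk_back] assms unfolding H_def by fastforce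
qed simp

text \<open>Each test costs \<open>2 * n + 3\<close>, and after a failed one \<open>n + 1\<close>
  more steps advance \<open>B\<close>. The position \<open>d'\<close> depends on where the loop is
  left; it stays existential, since head 4 is rewound before its next use.\<close>

lemma loop_D:
  assumes "a < m" "b < m" "d \<le> m"
  shows "\<exists>d' \<le> m. reaches mstep (Loop 4, H a b d) ((m - d) * (3 * n + 4) + 1)
    (if \<forall>x \<in> {d..<m}. sat a b x then (Acc, H a b d') else (Loop 3, H a (Suc b) d'))"
  using assms(3)
proof (induction "m - d" arbitrary: d)
  case 0
  then have d: "d = m" by simp
  then have "mstep (Loop 4, H a b d) = (Acc, H a b d)"
    by (simp add: H_def symbol_at_end move_none)
  then have "reaches mstep (Loop 4, H a b d) ((m - d) * (3 * n + 4) + 1) (Acc, H a b d)"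
    by (rule reaches_step[OF _ reaches_refl[of _ _ 0]]) simp
  then show ?case using d by auto
next
  case (Suc x)
  then have d: "d < m" and x: "x = m - Suc d" by simp_all
  then have md: "m - d = Suc (m - Suc d)" and range: "{d..<m} = insert d {Suc d..<m}" by auto
  note t = test[OF assms(1,2) d]
  show ?case
  proof (cases "sat a b d")
    case True
    obtain d' where "d' \<le> m" and
      r: "reaches mstep (Loop 4, H a b (Suc d)) ((m - Suc d) * (3 * n + 4) + 1)
        (if \<forall>x \<in> {Suc d..<m}. sat a b x then (Acc, H a b d') else (Loop 3, H a (Suc b) d'))"
      using Suc.hyps(1)[OF x Suc_leI[OF d]] by blast
    have "reaches mstep (Loop 4, H a b d) ((m - d) * (3 * n + 4) + 1)
        (if \<forall>x \<in> {Suc d..<m}. sat a b x then (Acc, H a b d') else (Loop 3, H a (Suc b) d'))"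
      using t True by (intro reaches_trans[OF _ r, of _ "2 * n + 3"]) (simp_all add: md)
    moreover have "(\<forall>x \<in> {d..<m}. sat a b x) \<longleftrightarrow> (\<forall>x \<in> {Suc d..<m}. sat a b x)"
      using True unfolding range by blast
    ultimately show ?thesis using \<open>d' \<le> m\<close> by (simp only:) blast
  next
    case False
    have "reaches mstep (Skip 3 0, H a b (Suc d)) (Suc 0 * Suc n)
        (after_skip 3 0, (H a b (Suc d))(3 := pos (Suc (b + 0)) 0))"
      using assms by (intro skip) (auto simp: H_def)
    then have r: "reaches mstep (Skip 3 0, H a b (Suc d)) (Suc n) (Loop 3, H a (Suc b) (Suc d))"
      by (simp add: H_def after_skip_def)
    have "reaches mstep (Loop 4, H a b d) ((m - d) * (3 * n + 4) + 1) (Loop 3, H a (Suc b) (Suc d))"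
      using t False by (intro reaches_trans[OF _ r, of _ "2 * n + 3"]) (simp_all add: md)
    then show ?thesis using d False unfolding range by (auto intro!: exI[of _ "Suc d"])
  qed
qed

text \<open>One round of the loop over \<open>B\<close>: reset head 4, then run the loop over
  \<open>D\<close>.\<close>

definition "time_B = 2 * length w + m * (3 * n + 4) + 3"

lemma loop_B:
  assumes "a < m" "b \<le> m" "d \<le> m"
  shows "\<exists>b' \<le> m. \<exists>d' \<le> m. reaches mstep (Loop 3, H a b d) ((m - b) * time_B + n + 2)
    (if \<exists>y \<in> {b..<m}. \<forall>x \<in> {3..<m}. sat a y x then (Acc, H a b' d') else (Loop 2, H (Suc a) b' d'))"
  using assms(2,3)
proof (induction "m - b" arbitrary: b d)
  case 0
  then have b: "b = m" by simp
  then have s: "mstep (Loop 3, H a b d) = (Skip 2 0, H a b d)"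
    by (simp add: H_def symbol_at_end move_none)
  \<comment> \<open>With the list for \<open>B\<close> exhausted, head 2 moves to the next
    \<open>A\<close>; this accounts for the summand \<open>n + 2\<close> in the bound.\<close>
  have "reaches mstep (Skip 2 0, H a b d) (Suc 0 * Suc n)
      (after_skip 2 0, (H a b d)(2 := pos (Suc (a + 0)) 0))"
    using assms by (intro skip) (auto simp: H_def)
  then have "reaches mstep (Loop 3, H a b d) ((m - b) * time_B + n + 2) (Loop 2, H (Suc a) b d)"
    by (intro reaches_step[where f = mstep and t = "Suc n", OF s]) (simp_all add: H_def after_skip_def)
  then show ?case using b 0 by auto
next
  case (Suc z)
  then have b: "b < m" and z: "z = m - Suc b" by simp_all
  then have mb: "m - b = Suc (m - Suc b)" and range: "{b..<m} = insert b {Suc b..<m}" by auto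
  have s: "mstep (Loop 3, H a b d) = (Rewind 4, (H a b d)(4 := pos d 0 - 1))"
    using symbol_at_block[OF b] by (simp add: H_def move_single)
  have "reaches mstep (Rewind 4, (H a b d)(4 := pos d 0 - 1)) (Suc (2 * length w))
      (Loop 4, ((H a b d)(4 := pos d 0 - 1))(4 := pos 3 0))"
    using Suc.prems by (intro rewind_skip) auto
  then have r1: "reaches mstep (Loop 3, H a b d) (2 * length w + 2) (Loop 4, H a b 3)"
    by (intro reaches_step[where f = mstep and t = "Suc (2 * length w)", OF s]) (simp_all add: H_def)
  obtain d' where "d' \<le> m" and
    r2: "reaches mstep (Loop 4, H a b 3) ((m - 3) * (3 * n + 4) + 1)
      (if \<forall>x \<in> {3..<m}. sat a b x then (Acc, H a b d') else (Loop 3, H a (Suc b) d'))"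
    using loop_D[OF assms(1) b Bs(1)] by blast
  have "(m - 3) * (3 * n + 4) \<le> m * (3 * n + 4)" by (rule mult_le_mono1) simp
  then have r: "reaches mstep (Loop 3, H a b d) time_B
      (if \<forall>x \<in> {3..<m}. sat a b x then (Acc, H a b d') else (Loop 3, H a (Suc b) d'))"
    by (intro reaches_trans[OF r1 r2]) (simp add: time_B_def)
  show ?case
  proof (cases "\<forall>x \<in> {3..<m}. sat a b x")
    case True
    have "reaches mstep (Loop 3, H a b d) time_B (Acc, H a b d')"
      using r unfolding if_P[OF True] .
    then have "reaches mstep (Loop 3, H a b d) ((m - b) * time_B + n + 2) (Acc, H a b d')"
      by (rule reaches_mono) (simp add: mb)
    moreover have "\<exists>y \<in> {b..<m}. \<forall>x \<in> {3..<m}. sat a y x"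
      using True unfolding range by blast
    ultimately show ?thesis using less_imp_le[OF b] \<open>d' \<le> m\<close> by (simp only: if_True) blast
  next
    case False
    obtain b2 d2 where "b2 \<le> m" "d2 \<le> m" and
      r3: "reaches mstep (Loop 3, H a (Suc b) d') ((m - Suc b) * time_B + n + 2)
      (if \<exists>y \<in> {Suc b..<m}. \<forall>x \<in> {3..<m}. sat a y x then (Acc, H a b2 d2) else (Loop 2, H (Suc a) b2 d2))"
      using Suc.hyps(1)[OF z Suc_leI[OF b] \<open>d' \<le> m\<close>] by blast
    have "reaches mstep (Loop 3, H a b d) ((m - b) * time_B + n + 2)
      (if \<exists>y \<in> {Suc b..<m}. \<forall>x \<in> {3..<m}. sat a y x then (Acc, H a b2 d2) else (Loop 2, H (Suc a) b2 d2))"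
      using r False by (intro reaches_trans[OF _ r3, of _ time_B]) (simp_all add: mb)
    moreover have "(\<exists>y \<in> {b..<m}. \<forall>x \<in> {3..<m}. sat a y x) \<longleftrightarrow> (\<exists>y \<in> {Suc b..<m}. \<forall>x \<in> {3..<m}. sat a y x)"
      using False unfolding range by blast
    ultimately show ?thesis using \<open>b2 \<le> m\<close> \<open>d2 \<le> m\<close> by (simp only:) blast
  qed
qed

definition "time_A = 2 * length w + m * time_B + n + 4"

lemma loop_A:
  assumes "a \<le> m" "b \<le> m" "d \<le> m"
  shows "\<exists>h. reaches mstep (Loop 2, H a b d) ((m - a) * time_A + 1)
    (if \<exists>z \<in> {a..<m}. \<exists>y \<in> {3..<m}. \<forall>x \<in> {3..<m}. sat z y x then Acc else Rej, h)"
  using assms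
proof (induction "m - a" arbitrary: a b d)
  case 0
  then have a: "a = m" by simp
  then have "mstep (Loop 2, H a b d) = (Rej, H a b d)"
    by (simp add: H_def symbol_at_end move_none)
  then have "reaches mstep (Loop 2, H a b d) ((m - a) * time_A + 1) (Rej, H a b d)"
    by (rule reaches_step[OF _ reaches_refl[of _ _ 0]]) simp
  then show ?case using a by auto
next
  case (Suc z)
  then have a: "a < m" and z: "z = m - Suc a" by simp_all
  then have ma: "m - a = Suc (m - Suc a)" and range: "{a..<m} = insert a {Suc a..<m}" by auto
  have s: "mstep (Loop 2, H a b d) = (Rewind 3, (H a b d)(3 := pos b 0 - 1))"
    using symbol_at_block[OF a] by (simp add: H_def move_single)
  have "reaches mstep (Rewind 3, (H a b d)(3 := pos b 0 - 1)) (Suc (2 * length w))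
      (Loop 3, ((H a b d)(3 := pos b 0 - 1))(3 := pos 3 0))"
    using Suc.prems by (intro rewind_skip) auto
  then have r1: "reaches mstep (Loop 2, H a b d) (2 * length w + 2) (Loop 3, H a 3 d)"
    by (intro reaches_step[where f = mstep and t = "Suc (2 * length w)", OF s]) (simp_all add: H_def)
  obtain b' d' where "b' \<le> m" "d' \<le> m" and
    r2: "reaches mstep (Loop 3, H a 3 d) ((m - 3) * time_B + n + 2)
      (if \<exists>y \<in> {3..<m}. \<forall>x \<in> {3..<m}. sat a y x then (Acc, H a b' d') else (Loop 2, H (Suc a) b' d'))"
    using loop_B[OF a Bs(1) Suc.prems(3)] by blast
  have "(m - 3) * time_B \<le> m * time_B" by (rule mult_le_mono1) simp
  then have r: "reaches mstep (Loop 2, H a b d) time_A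
      (if \<exists>y \<in> {3..<m}. \<forall>x \<in> {3..<m}. sat a y x then (Acc, H a b' d') else (Loop 2, H (Suc a) b' d'))"
    by (intro reaches_trans[OF r1 r2]) (simp add: time_A_def)
  show ?case
  proof (cases "\<exists>y \<in> {3..<m}. \<forall>x \<in> {3..<m}. sat a y x")
    case True
    with r have "reaches mstep (Loop 2, H a b d) time_A (Acc, H a b' d')"
      by (simp only: if_True)
    then have "reaches mstep (Loop 2, H a b d) ((m - a) * time_A + 1) (Acc, H a b' d')"
      by (rule reaches_mono) (simp add: ma)
    moreover have "\<exists>z \<in> {a..<m}. \<exists>y \<in> {3..<m}. \<forall>x \<in> {3..<m}. sat z y x"
      using True unfolding range by blast
    ultimately show ?thesis by (simp only: if_True) blast
  next
    case False
    obtain h where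
      r3: "reaches mstep (Loop 2, H (Suc a) b' d') ((m - Suc a) * time_A + 1)
      (if \<exists>z \<in> {Suc a..<m}. \<exists>y \<in> {3..<m}. \<forall>x \<in> {3..<m}. sat z y x then Acc else Rej, h)"
      using Suc.hyps(1)[OF z Suc_leI[OF a] \<open>b' \<le> m\<close> \<open>d' \<le> m\<close>] by blast
    have "reaches mstep (Loop 2, H a b d) ((m - a) * time_A + 1)
      (if \<exists>z \<in> {Suc a..<m}. \<exists>y \<in> {3..<m}. \<forall>x \<in> {3..<m}. sat z y x then Acc else Rej, h)"
      using r False by (intro reaches_trans[OF _ r3, of _ time_A]) (simp_all add: ma)
    moreover have "(\<exists>z \<in> {a..<m}. \<exists>y \<in> {3..<m}. \<forall>x \<in> {3..<m}. sat z y x) \<longleftrightarrow>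
        (\<exists>z \<in> {Suc a..<m}. \<exists>y \<in> {3..<m}. \<forall>x \<in> {3..<m}. sat z y x)"
      using False unfolding range by blast
    ultimately show ?thesis by (simp only:) blast
  qed
qed

section \<open>Total running time and result\<close>

lemma start:
  "reaches mstep (Skip 0 0, \<lambda>_. 0) (6 * Suc n) (Loop 2, H 3 0 0)"
proof -
  let ?h0 = "heads (pos 0 0) (pos 0 0) (pos 0 0) (pos 0 0) (pos 0 0)"
  let ?h1 = "heads (pos 1 0) (pos 0 0) (pos 0 0) (pos 0 0) (pos 0 0)"
  let ?h2 = "heads (pos 1 0) (pos 2 0) (pos 0 0) (pos 0 0) (pos 0 0)"
  have h0: "(\<lambda>_. 0) = ?h0"
    by (auto simp: heads_def pos_def)
  have "reaches mstep (Skip 0 0, ?h0) (Suc 0 * Suc n) (after_skip 0 0, ?h0(0 := pos (Suc (0 + 0)) 0))"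
    using Bs(1) by (intro skip) auto
  then have "reaches mstep (Skip 0 0, \<lambda>_. 0) (Suc n) (Skip 1 1, ?h1)"
    unfolding h0 by (simp add: after_skip_def)
  moreover have "reaches mstep (Skip 1 1, ?h1) (Suc 1 * Suc n) (after_skip 1 0, ?h1(1 := pos (Suc (0 + 1)) 0))"
    using Bs(1) by (intro skip) auto
  then have "reaches mstep (Skip 1 1, ?h1) (2 * Suc n) (Skip 2 2, ?h2)"
    by (simp add: after_skip_def numeral_2_eq_2)
  moreover have "reaches mstep (Skip 2 2, ?h2) (Suc 2 * Suc n) (after_skip 2 0, ?h2(2 := pos (Suc (0 + 2)) 0))"
    using Bs(1) by (intro skip) auto
  then have "reaches mstep (Skip 2 2, ?h2) (3 * Suc n) (Loop 2, H 3 0 0)"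
    by (simp add: after_skip_def H_def numeral_3_eq_3)
  ultimately have "reaches mstep (Skip 0 0, \<lambda>_. 0) (Suc n + 2 * Suc n + 3 * Suc n) (Loop 2, H 3 0 0)"
    by (blast intro: reaches_trans order.refl)
  then show ?thesis by (simp add: algebra_simps)
qed

text \<open>Everything follows from \<open>m * Suc n\<close> being the input length
  \<open>L\<close>: a round for \<open>B\<close> is linear in \<open>L\<close>, a round for
  \<open>A\<close> quadratic, and the whole search cubic.\<close>

lemma time_bound:
  "6 * Suc n + ((m - 3) * time_A + 1) \<le> poly [:1, 8, 8, 6:] (length w)"
proof -
  let ?L = "length w"
  have L: "m * Suc n = ?L" by (simp only: length_w)
  have n: "3 * Suc n \<le> ?L" using mult_le_mono1[OF Bs(1), of "Suc n"] unfolding L .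
  have m: "m \<le> ?L" unfolding L[symmetric] by simp
  have "m * (3 * n + 4) \<le> 4 * ?L" unfolding L[symmetric] by (simp add: algebra_simps)
  then have "time_B \<le> 6 * ?L + 3" by (simp add: time_B_def)
  then have "m * time_B \<le> ?L * (6 * ?L + 3)" using m by (rule mult_le_mono[rotated])
  then have "time_A \<le> 6 * (?L * ?L) + 6 * ?L + 4" using n by (simp add: time_A_def algebra_simps)
  moreover have "m - 3 \<le> ?L" using m by simp
  ultimately have "(m - 3) * time_A \<le> ?L * (6 * (?L * ?L) + 6 * ?L + 4)" by (intro mult_le_mono)
  then show ?thesis using n by (simp add: algebra_simps)
qed

lemma search_result:
  "\<exists>t \<le> poly [:1, 8, 8, 6:] (length w). fst ((mstep ^^ t) (Skip 0 0, \<lambda>_. 0)) =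
     (if \<exists>a \<in> {3..<m}. \<exists>b \<in> {3..<m}. \<forall>d \<in> {3..<m}. sat a b d then Acc else Rej)"
proof -
  obtain h where "reaches mstep (Loop 2, H 3 0 0) ((m - 3) * time_A + 1)
    (if \<exists>z \<in> {3..<m}. \<exists>y \<in> {3..<m}. \<forall>x \<in> {3..<m}. sat z y x then Acc else Rej, h)"
    using loop_A[of 3 0 0] Bs(1) by auto
  from reaches_trans[OF start this time_bound] show ?thesis
    unfolding reaches_def by (elim exE conjE, intro exI conjI) (assumption, simp only: fst_conv)
qed

end

lemma ex_index_shift: "(\<exists>i \<in> {3..<length (x # y # z # Xs)}. P ((x # y # z # Xs) ! i)) \<longleftrightarrow> (\<exists>A \<in> set Xs. P A)"
proof -
  have len: "length (x # y # z # Xs) = length Xs + 3" by simp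
  have "{3..<length (x # y # z # Xs)} = (\<lambda>i. i + 3) ` {0..<length Xs}"
    by (simp only: len image_add_atLeastLessThan' add_0)
  then have "(\<exists>i \<in> {3..<length (x # y # z # Xs)}. P ((x # y # z # Xs) ! i)) \<longleftrightarrow>
      (\<exists>i \<in> {0..<length Xs}. P ((x # y # z # Xs) ! (i + 3)))"
    by (simp only:) blast
  also have "\<dots> \<longleftrightarrow> (\<exists>i < length Xs. P (Xs ! i))"
    by (simp add: numeral_3_eq_3) auto
  also have "\<dots> \<longleftrightarrow> (\<exists>A \<in> set Xs. P A)"
    by (metis in_set_conv_nth)
  finally show ?thesis .
qed

theorem proposition2p1:
  fixes X :: representation
  shows "poly_time_solvable encode (instances X) extends_to_2_trade"
proof (rule poly_time_solvable_by_multihead[where Q = states and a = Acc and r = Rej and k = 5 and s = 4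
      and ?q0.0 = "Skip 0 0" and \<delta> = "transition X" and p = "[:1, 8, 8, 6:]"])
  show "finite states" by (rule finite_states)
  show "Skip 0 0 \<in> states" "Acc \<in> states" "Rej \<in> states" by (auto simp: states_def)
  show "fst (transition X q r) \<in> states" if "q \<in> states" for q r using that by (rule transition_closed)
  show "set (encode x) \<subseteq> {0<..<4}" if "x \<in> instances X" for x
    by (cases x) (simp only: encode.simps set_encoding)
  show "\<exists>t \<le> poly [:1, 8, 8, 6:] (length (encode x)).
      fst ((mh_step (transition X) Acc Rej 5 (encode x) ^^ t) (Skip 0 0, \<lambda>_. 0)) =
        (if extends_to_2_trade x then Acc else Rej)" if x: "x \<in> instances X" for x
  proof -
    obtain n W Xs S1 S2 where x_eq: "x = (n, W, Xs, S1, S2)" by (cases x)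
    let ?Bs = "{1..n} # S1 # S2 # Xs"
    have "family X n W \<subseteq> Pow {1..n}"
      using x by (cases X) (auto simp: x_eq instances_def simple_game_def losing_def minimal_winning_def)
    then interpret search X n ?Bs
      using x by unfold_locales (auto simp: x_eq instances_def losing_def)
    \<comment> \<open>Writing the universal quantifier as a negated existential lets
      \<open>ex_index_shift\<close> translate all three quantifiers.\<close>
    have "(\<exists>a \<in> {3..<length ?Bs}. \<exists>b \<in> {3..<length ?Bs}. \<forall>d \<in> {3..<length ?Bs}. sat a b d) \<longleftrightarrow>
        (\<exists>A \<in> set Xs. \<exists>B \<in> set Xs. \<not> (\<exists>D \<in> set Xs. \<not> good X S1 S2 A B D))" (is "?search \<longleftrightarrow> _")
      unfolding ex_index_shift[of "{1..n}" S1 S2 Xs, symmetric] sat_def by simp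
    also have "\<dots> \<longleftrightarrow> extends_to_2_trade x"
      using extends_iff_good x unfolding x_eq by blast
    finally have "?search \<longleftrightarrow> extends_to_2_trade x" .
    moreover have "w = encode x" unfolding w_def x_eq encode.simps ..
    ultimately show ?thesis using search_result by (simp only:)
  qed
qed simp_all

end
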